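(* Let $G=(V,E)$ be a finite, connected graph with $V=\{1,\ldots,m\}$ and $|E|=N\ge1$ which is not balanced bipartite, and let $\alpha=1$. Let $x(n)=(x_1(n),\ldots,x_m(n))$, $n\ge 0$, be the proportions of balls in the generalized Pólya urn process on $G$ with parameter $\alpha=1$ (defined in the context), for arbitrary initial numbers of balls $B_i(0)\ge 1$. Then the equilibria set $\Lambda$ (defined in the context, with $\alpha=1$) is finite, and almost surely $x(n)$ converges, as $n\to\infty$, to an element of $\Lambda$ (which may be random).
   Context: Graphs are simple and undirected; $i\sim j$ means $\{i,j\}\in E$. $G$ is called balanced bipartite if there is a bipartition $V=A\cup B$ of $G$ with $\#A=\#B$. Generalized Pólya urn process on $G$ with parameter $\alpha>0$: each vertex $i$ carries a bin, initially with an integer number $B_i(0)\ge 1$ of balls. Let $\mathcal F_n$ be the sigma-algebra generated by the process up to step $n$. At step $n+1$, for each edge $\{i,j\}\in E$ exactly one ball is added, either to $i$ or to $j$; conditionally on $\mathcal F_n$, the ball is added to $i$ with probability $\frac{B_i(n)^\alpha}{B_i(n)^\alpha+B_j(n)^\alpha}$ (and to $j$ otherwise), and the choices for distinct edges are independent. $B_i(n)$ is the number of balls at $i$ after step $n$. With $N_0=\sum_{i=1}^m B_i(0)$, set $x_i(n)=\frac{B_i(n)}{N_0+nN}$. Vector field and equilibria set: fix a constant $0<c<1/N$ and let $\Delta$ be the set of $(x_1,\ldots,x_m)\in\mathbb{R}^m$ with $x_i\ge 0$ for all $i$, $\sum_{i=1}^m x_i=1$, and $x_i+x_j\ge c$ for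 all $\{i,j\}\in E$. Define $F=(F_1,\ldots,F_m)$ on $\Delta$ by $$F_i(x_1,\ldots,x_m)=-x_i+\frac1N\sum_{j\sim i}\frac{x_i^\alpha}{x_i^\alpha+x_j^\alpha}.$$ The equilibria set is $\Lambda=\{x\in\Delta: F(x)=0\}$. *)

theory Defs
  imports "HOL-Probability.Probability"
begin

section \<open>Finite simple graphs on the vertex set UNIV\<close>

text \<open>The \<open>m\<close> vertices are the elements of a finite type; edges are two-element sets.\<close>

definition simple_graph :: "'v::finite set set \<Rightarrow> bool" where
  "simple_graph E \<longleftrightarrow> (\<forall>e\<in>E. card e = 2)"

definition graph_connected :: "'v::finite set set \<Rightarrow> bool" where
  "graph_connected E \<longleftrightarrow> (\<forall>u v. (u, v) \<in> {(i, j). {i, j} \<in> E}\<^sup>*)"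

definition balanced_bipartite :: "'v::finite set set \<Rightarrow> bool" where
  "balanced_bipartite E \<longleftrightarrow>
     (\<exists>A B. A \<union> B = UNIV \<and> A \<inter> B = {} \<and> (\<forall>e\<in>E. \<exists>a\<in>A. \<exists>b\<in>B. e = {a, b}) \<and> card A = card B)"


section \<open>Conditional independence\<close>

text \<open>Analogue of \<^const>\<open>prob_space.indep_vars\<close>, with conditional probabilities given the
  sub-sigma-algebra \<open>F\<close> in place of probabilities.\<close>

definition cond_indep_vars ::
    "'w measure \<Rightarrow> 'w measure \<Rightarrow> ('i \<Rightarrow> 'a measure) \<Rightarrow> ('i \<Rightarrow> 'w \<Rightarrow> 'a) \<Rightarrow> 'i set \<Rightarrow> bool" where
  "cond_indep_vars M F M' X I \<longleftrightarrow>
     (\<forall>i\<in>I. X i \<in> measurable M (M' i)) \<and>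
     (\<forall>J\<subseteq>I. finite J \<longrightarrow> (\<forall>A\<in>(\<Pi> i\<in>J. sets (M' i)).
        AE \<omega> in M.
          real_cond_exp M F (indicator {\<omega> \<in> space M. \<forall>i\<in>J. X i \<omega> \<in> A i}) \<omega> =
          (\<Prod>i\<in>J. real_cond_exp M F (indicator {\<omega> \<in> space M. X i \<omega> \<in> A i}) \<omega>)))"


section \<open>The generalized Polya urn process\<close>

text \<open>The sigma-algebra generated by the ball counts up to step \<open>n\<close>.\<close>

definition history :: "'w measure \<Rightarrow> (nat \<Rightarrow> 'v \<Rightarrow> 'w \<Rightarrow> nat) \<Rightarrow> nat \<Rightarrow> 'w measure" where
  "history M B n = sigma (space M) {{\<omega> \<in> space M. B k i \<omega> = b} | k i b. k \<le> n}"

text \<open>\<open>B n i\<close> is the number of balls at vertex \<open>i\<close> after step \<open>n\<close>, \<open>b\<close> is the (deterministic)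
  initial configuration, and \<open>X n e\<close> is the endpoint of the edge \<open>e\<close> that receives the ball
  of \<open>e\<close> at step \<open>n + 1\<close>.\<close>

locale polya_urn = prob_space M
  for M :: "'w measure" +
  fixes E :: "'v::finite set set"
    and \<alpha> :: real
    and b :: "'v \<Rightarrow> nat"
    and X :: "nat \<Rightarrow> 'v set \<Rightarrow> 'w \<Rightarrow> 'v"
    and B :: "nat \<Rightarrow> 'v \<Rightarrow> 'w \<Rightarrow> nat"
  assumes simple: "simple_graph E"
    and alpha_pos: "\<alpha> > 0"
    and initial_pos: "\<And>i. b i \<ge> 1"
    and choice_measurable: "\<And>n e. e \<in> E \<Longrightarrow> X n e \<in> measurable M (count_space UNIV)"
    and choice_endpoint: "\<And>n e \<omega>. e \<in> E \<Longrightarrow> \<omega> \<in> space M \<Longrightarrow> X n e \<omega> \<in> e"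
    and balls_0: "\<And>i \<omega>. \<omega> \<in> space M \<Longrightarrow> B 0 i \<omega> = b i"
    and balls_Suc: "\<And>n i \<omega>. \<omega> \<in> space M \<Longrightarrow>
          B (Suc n) i \<omega> = B n i \<omega> + card {e \<in> E. X n e \<omega> = i}"
    and choice_prob: "\<And>n i j. {i, j} \<in> E \<Longrightarrow>
          AE \<omega> in M.
            real_cond_exp M (history M B n) (indicator {\<omega> \<in> space M. X n {i, j} \<omega> = i}) \<omega> =
            real (B n i \<omega>) powr \<alpha> / (real (B n i \<omega>) powr \<alpha> + real (B n j \<omega>) powr \<alpha>)"
    and choice_indep: "\<And>n.
          cond_indep_vars M (history M B n) (\<lambda>_. count_space UNIV) (X n) E"

definition proportions ::
    "'v::finite set set \<Rightarrow> (nat \<Rightarrow> 'v \<Rightarrow> 'w \<Rightarrow> nat) \<Rightarrow> nat \<Rightarrow> 'w \<Rightarrow> real ^ 'v" where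
  "proportions E B n \<omega> =
     (\<chi> i. real (B n i \<omega>) / (real (\<Sum>j\<in>UNIV. B 0 j \<omega>) + real n * real (card E)))"


section \<open>The vector field and its equilibria\<close>

definition Delta :: "'v::finite set set \<Rightarrow> real \<Rightarrow> (real ^ 'v) set" where
  "Delta E c = {x. (\<forall>i. x $ i \<ge> 0) \<and> (\<Sum>i\<in>UNIV. x $ i) = 1 \<and>
                   (\<forall>i j. {i, j} \<in> E \<longrightarrow> x $ i + x $ j \<ge> c)}"

definition vector_field :: "'v::finite set set \<Rightarrow> real \<Rightarrow> real ^ 'v \<Rightarrow> real ^ 'v" where
  "vector_field E \<alpha> x =
     (\<chi> i. - (x $ i) + 1 / real (card E) *
        (\<Sum>j | {i, j} \<in> E. (x $ i) powr \<alpha> / ((x $ i) powr \<alpha> + (x $ j) powr \<alpha>)))"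

definition equilibria :: "'v::finite set set \<Rightarrow> real \<Rightarrow> real \<Rightarrow> (real ^ 'v) set" where
  "equilibria E \<alpha> c = {x \<in> Delta E c. vector_field E \<alpha> x = 0}"

end

theory Submission
  imports Defs
begin

text \<open>The proportions satisfy \<open>x(n+1) = x(n) + \<gamma>(n) F(x(n)) + W(n)\<close> with \<open>\<gamma>(n)\<close> of order \<open>1/n\<close> and \<open>W(n)\<close> a bounded
  martingale difference of order \<open>1/n\<close>. For \<open>\<alpha> = 1\<close> the field is \<open>F\<^sub>i(x) = x\<^sub>i (G\<^sub>i(x) - 1)\<close>, where up to a constant
  \<open>G\<close> is the gradient of the concave function \<open>S(x) = \<Sum> ln (x\<^sub>i + x\<^sub>j)\<close> over the edges. Hence \<open>S\<close> increases along the
  process by at least a multiple of \<open>\<gamma>(n) \<bar>F(x(n))\<bar>\<^sup>2\<close>, up to convergent noise and \<open>O(1/n\<^sup>2)\<close>; as \<open>S \<le> 0\<close>, the series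
  \<open>\<Sum> \<gamma>(n) \<bar>F(x(n))\<bar>\<^sup>2\<close> converges almost surely. Since \<open>\<Sum> \<gamma>(n)\<close> diverges, this forces every limit point to be a zero
  of \<open>F\<close>. There are finitely many zeros and the steps tend to \<open>0\<close>, so the process converges.\<close>

section \<open>Deterministic stochastic approximation\<close>

text \<open>If \<open>F z\<close> were nonzero, the drift would stay bounded away from 0 near
  \<open>z\<close>, so leaving a ball around \<open>z\<close> would cost a fixed amount of energy. A
  late visit close to \<open>z\<close> would then last forever, and the energy would dominate a
  multiple of \<open>\<gamma>\<close>, whose series diverges.\<close>

lemma subsequence_limit_zero_of_drift:
  fixes x :: "nat \<Rightarrow> 'a::banach" and F :: "'a \<Rightarrow> 'a"
  assumes step: "\<And>n. x (Suc n) = x n + \<gamma> n *\<^sub>R F (x n) + W n"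
    and nonneg: "\<And>n. \<gamma> n \<ge> 0"
    and diverges: "\<not> summable \<gamma>"
    and noise: "summable W"
    and energy: "summable (\<lambda>n. \<gamma> n * (norm (F (x n)))\<^sup>2)"
    and cont: "isCont F z"
    and r: "strict_mono r" "(x \<circ> r) \<longlonglongrightarrow> z"
  shows "F z = 0"
proof (rule ccontr)
  assume "F z \<noteq> 0"
  define c where "c = norm (F z) / 2"
  have c: "c > 0" using \<open>F z \<noteq> 0\<close> by (simp add: c_def)
  have "((\<lambda>y. norm (F y)) \<longlongrightarrow> norm (F z)) (at z)"
    using cont by (intro tendsto_norm) (simp add: isCont_def)
  then have "isCont (\<lambda>y. norm (F y)) z"
    by (simp add: isCont_def)
  then obtain d where d: "d > 0" and "\<forall>y. dist y z < d \<longrightarrow> dist (norm (F y)) (norm (F z)) < c"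
    using c unfolding continuous_at_eps_delta by blast
  then have large: "norm (F y) \<ge> c" if "dist y z < d" for y
    using that by (smt (verit) c_def dist_real_def field_sum_of_halves)
  let ?e = "\<lambda>n. \<gamma> n * (norm (F (x n)))\<^sup>2"
  \<comment> \<open>Budget for staying within \<open>d\<close>: the start uses \<open>d / 2\<close>,
    drift and noise use \<open>d / 4\<close> each. Where the norm of \<open>F\<close> is at least
    \<open>c\<close>, energy is at least \<open>c\<close> times the drift displacement, hence the
    threshold \<open>c * d / 4\<close>.\<close>
  have "c * d / 4 > 0" "d / 4 > 0" using c d by auto
  obtain N1 where N1: "\<And>m n. m \<ge> N1 \<Longrightarrow> norm (sum ?e {m..<n}) < c * d / 4"
    using energy \<open>c * d / 4 > 0\<close> unfolding summable_Cauchy by blast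
  obtain N2 where N2: "\<And>m n. m \<ge> N2 \<Longrightarrow> norm (sum W {m..<n}) < d / 4"
    using noise \<open>d / 4 > 0\<close> unfolding summable_Cauchy by blast
  obtain N3 where N3: "\<And>n. n \<ge> N3 \<Longrightarrow> dist (x (r n)) z < d / 2"
    using r(2) d unfolding lim_sequentially by (metis comp_apply half_gt_zero)
  define s where "s = r (max N3 (max N1 N2))"
  have s: "s \<ge> N1" "s \<ge> N2" "dist (x s) z < d / 2"
    using seq_suble[OF r(1), of "max N3 (max N1 N2)"] N3[of "max N3 (max N1 N2)"]
    by (auto simp: s_def)
  have tele: "x m - x s = (\<Sum>k=s..<m. \<gamma> k *\<^sub>R F (x k)) + (\<Sum>k=s..<m. W k)" if "m \<ge> s" for m
    using that by (induction m rule: dec_induct) (auto simp: step algebra_simps)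
  \<comment> \<open>Near \<open>z\<close> the drift is at least \<open>c\<close>, so travelling costs energy; the remaining energy and
    noise are too small for the trajectory ever to leave the ball.\<close>
  have trapped: "dist (x m) z < d" if "m \<ge> s" for m
    using that
  proof (induction m rule: less_induct)
    case (less m)
    have "norm (\<Sum>k=s..<m. \<gamma> k *\<^sub>R F (x k)) \<le> (\<Sum>k=s..<m. ?e k / c)"
    proof (rule sum_norm_le)
      fix k assume "k \<in> {s..<m}"
      then have "norm (F (x k)) \<ge> c" using less.IH large by auto
      then have "norm (F (x k)) * c \<le> (norm (F (x k)))\<^sup>2"
        by (simp add: power2_eq_square mult_left_mono)
      then show "norm (\<gamma> k *\<^sub>R F (x k)) \<le> ?e k / c"
        using c nonneg[of k] mult_left_mono[of "norm (F (x k)) * c" "(norm (F (x k)))\<^sup>2" "\<gamma> k"]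
        by (simp add: pos_le_divide_eq ac_simps)
    qed
    also have "\<dots> = sum ?e {s..<m} / c" by (simp add: sum_divide_distrib)
    also have "\<dots> \<le> d / 4" using N1[of s m] s(1) c by (simp add: field_simps)
    finally have "norm (\<Sum>k=s..<m. \<gamma> k *\<^sub>R F (x k)) \<le> d / 4" .
    moreover have "norm (sum W {s..<m}) < d / 4" using N2 s by blast
    ultimately have "norm (x m - x s) < d / 2"
      unfolding tele[OF less.prems] 
      using norm_triangle_ineq[of "\<Sum>k=s..<m. \<gamma> k *\<^sub>R F (x k)" "sum W {s..<m}"] by linarith
    then show ?case using s(3) dist_triangle[of "x m" z "x s"] by (simp add: dist_norm)
  qed
  have "summable (\<lambda>n. ?e n / c\<^sup>2)" using energy by (rule summable_divide)
  moreover have "norm (\<gamma> n) \<le> ?e n / c\<^sup>2" if "n \<ge> s" for n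
  proof -
    have "c\<^sup>2 \<le> (norm (F (x n)))\<^sup>2"
      using large[OF trapped[OF that]] c by (intro power_mono) auto
    then show ?thesis using c nonneg[of n] by (simp add: field_simps mult_left_mono)
  qed
  ultimately have "summable \<gamma>" by (rule summable_comparison_test'[where N = s])
  with diverges show False ..
qed

text \<open>Compactness gives a limit point \<open>z\<close>, isolated in \<open>Z\<close>. A thin
  shell around it contains no limit point and so is visited only finitely often, and steps shorter
  than its thickness cannot cross it.\<close>

lemma convergent_of_finite_limit_set:
  fixes x :: "nat \<Rightarrow> 'a::metric_space"
  assumes "compact K" and inK: "\<And>n. x n \<in> K"
    and steps: "(\<lambda>n. dist (x (Suc n)) (x n)) \<longlonglongrightarrow> 0"
    and "finite Z"
    and limits: "\<And>r z. strict_mono r \<Longrightarrow> (x \<circ> r) \<longlonglongrightarrow> z \<Longrightarrow> z \<in> Z"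
  shows "\<exists>z\<in>Z. x \<longlonglongrightarrow> z"
proof -
  obtain z r where r: "strict_mono r" "(x \<circ> r) \<longlonglongrightarrow> z"
    using \<open>compact K\<close> inK unfolding compact_def by metis
  have "z \<in> Z" using limits r by blast
  obtain d where d: "d > 0" and sep: "\<And>y. y \<in> Z \<Longrightarrow> y \<noteq> z \<Longrightarrow> d \<le> dist z y"
    using finite_set_avoid[OF \<open>finite Z\<close>, of z] by auto
  have "x \<longlonglongrightarrow> z"
    unfolding lim_sequentially
  proof (intro allI impI)
    fix e0 :: real assume "e0 > 0"
    \<comment> \<open>The shell \<open>A\<close> between the radii \<open>e\<close> and
      \<open>2 * e\<close> has to avoid the other points of \<open>Z\<close>, hence
      \<open>2 * e < d\<close>, and to lie within the target radius \<open>e0\<close>.\<close>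
    define e where "e = min e0 (d / 2) / 2"
    have e: "e > 0" "2 * e \<le> e0" "2 * e < d" using d \<open>e0 > 0\<close> by (auto simp: e_def)
    define A where "A = {y. e \<le> dist y z} \<inter> {y. dist y z \<le> 2 * e}"
    have "closed A" unfolding A_def
      by (intro closed_Int closed_Collect_le continuous_intros)
    have "finite {n. x n \<in> A}"
    proof (rule ccontr)
      assume inf: "infinite {n. x n \<in> A}"
      define q where "q = enumerate {n. x n \<in> A}"
      have q: "strict_mono q" "\<And>n. x (q n) \<in> A"
        using inf enumerate_in_set[OF inf] by (auto simp: q_def strict_mono_enumerate)
      have "compact (K \<inter> A)" using \<open>compact K\<close> \<open>closed A\<close> by blast
      then obtain y p where p: "strict_mono p" "((x \<circ> q) \<circ> p) \<longlonglongrightarrow> y" "y \<in> K \<inter> A"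
        using inK q(2) unfolding compact_def by (metis (no_types, lifting) IntI comp_apply)
      then have "y \<in> Z"
        using limits[of "q \<circ> p" y] q(1) by (simp add: strict_mono_o comp_assoc)
      moreover have "y \<noteq> z" "dist z y < d"
        using p(3) e by (auto simp: A_def dist_commute)
      ultimately show False using sep by force
    qed
    then obtain N1 where "\<forall>n\<in>{n. x n \<in> A}. n < N1" using finite_nat_set_iff_bounded by auto
    then have N1: "x n \<notin> A" if "n \<ge> N1" for n using that by fastforce
    obtain N2 where N2: "\<And>n. n \<ge> N2 \<Longrightarrow> dist (x (Suc n)) (x n) < e"
      using steps e(1) unfolding lim_sequentially by auto
    obtain N3 where N3: "\<And>n. n \<ge> N3 \<Longrightarrow> dist (x (r n)) z < e"
      using r(2) e(1) unfolding lim_sequentially by (metis comp_apply)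
    define s where "s = r (max N3 (max N1 N2))"
    have s: "s \<ge> N1" "s \<ge> N2" "dist (x s) z < e"
      using seq_suble[OF r(1), of "max N3 (max N1 N2)"] N3[of "max N3 (max N1 N2)"]
      by (auto simp: s_def)
    have "dist (x n) z < e" if "n \<ge> s" for n
      using that
    proof (induction n rule: dec_induct)
      case base show ?case by (fact s)
    next
      case (step n)
      \<comment> \<open>A step below \<open>e\<close> from inside radius \<open>e\<close> ends
        inside radius \<open>2 * e\<close>; since the shell is no longer visited, the point is again
        inside radius \<open>e\<close>.\<close>
      have "dist (x (Suc n)) z < 2 * e"
        using N2[of n] step s dist_triangle[of "x (Suc n)" z "x n"] by auto
      then show ?case using N1[of "Suc n"] step s by (force simp: A_def)
    qed
    then show "\<exists>no. \<forall>n\<ge>no. dist (x n) z < e0" using e by (intro exI[of _ s]) force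
  qed
  then show ?thesis using \<open>z \<in> Z\<close> by blast
qed

text \<open>Deterministic core of the Lyapunov argument: summation telescopes \<open>s\<close>,
  which is bounded above, and the partial sums of \<open>w\<close> are bounded, so those of
  \<open>a\<close> are bounded as well.\<close>

lemma summable_of_bounded_telescope:
  fixes a s w :: "nat \<Rightarrow> real"
  assumes "\<And>n. 0 \<le> a n" and a_le: "\<And>n. a n \<le> s (Suc n) - s n + w n"
    and upper: "\<And>n. s n \<le> u" and "summable w"
  shows "summable a"
proof -
  obtain K where K: "\<And>n. \<bar>sum w {..<n}\<bar> \<le> K"
    using \<open>summable w\<close> convergent_imp_Bseq[of "\<lambda>n. sum w {..<n}"]
    by (auto simp: summable_iff_convergent Bseq_def)
  have "sum a {..<n} \<le> s n - s 0 + sum w {..<n}" for n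
  proof (induction n)
    case (Suc n)
    then show ?case using a_le[of n] by simp
  qed simp
  then have "sum a {..<n} \<le> u - s 0 + K" for n
    using upper[of n] K[of n] by (smt (verit))
  with assms(1) show ?thesis by (rule summableI_nonneg_bounded)
qed

section \<open>Orthogonal series\<close>

text \<open>The number of indices in a cube block, and a comparison of
  \<open>1 / (k ^ 3 + 1)\<close> with \<open>1 / (k + 1) ^ 3\<close>. Together they turn termwise
  decay of order \<open>1 / n\<close> into block estimates.\<close>

lemma cube_block_bounds:
  "real (Suc k ^ 3) - real (k ^ 3) \<le> 3 * (real k + 1)\<^sup>2"
  "(real k + 1) ^ 3 \<le> 4 * (real (k ^ 3) + 1)"
proof -
  show "real (Suc k ^ 3) - real (k ^ 3) \<le> 3 * (real k + 1)\<^sup>2"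
    by (simp add: power2_eq_square power3_eq_cube algebra_simps)
  \<comment> \<open>The difference of the two sides has a double root at \<open>k = 1\<close>, where
    the constant 4 is attained.\<close>
  have "0 \<le> 3 * ((real k - 1)\<^sup>2 * (real k + 1))" by simp
  also have "\<dots> = 4 * (real (k ^ 3) + 1) - (real k + 1) ^ 3"
    by (simp add: power2_eq_square power3_eq_cube algebra_simps)
  finally show "(real k + 1) ^ 3 \<le> 4 * (real (k ^ 3) + 1)" by simp
qed

text \<open>Summable blocks give convergence of the partial sums along cubes. Inside block
  \<open>k\<close> the partial sums move by at most \<open>12 * C / (k + 1)\<close>, so the full
  sequence has the same limit.\<close>

lemma summable_of_cube_blocks:
  fixes f :: "nat \<Rightarrow> real"
  assumes bound: "\<And>n. \<bar>f n\<bar> \<le> C / (real n + 1)"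
    and blocks: "summable (\<lambda>k. \<Sum>n = k ^ 3..<Suc k ^ 3. f n)"
  shows "summable f"
proof -
  have "C \<ge> 0" using bound[of 0] by auto
  define s where "s n = sum f {..<n}" for n
  have s_diff: "s n - s m = sum f {m..<n}" if "m \<le> n" for m n
    using that unfolding s_def by (metis atLeast0LessThan sum_diff_nat_ivl zero_le)
  have "s (K ^ 3) = (\<Sum>k<K. \<Sum>n = k ^ 3..<Suc k ^ 3. f n)" for K
  proof (induction K)
    case (Suc K)
    have "s (Suc K ^ 3) - s (K ^ 3) = sum f {K ^ 3..<Suc K ^ 3}" by (intro s_diff power_mono) auto
    then show ?case using Suc by simp
  qed (simp add: s_def)
  with blocks obtain l where l: "(\<lambda>K. s (K ^ 3)) \<longlonglongrightarrow> l"
    by (auto simp: summable_def sums_def)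
  have "(\<lambda>k. 12 * C / (real k + 1)) \<longlonglongrightarrow> 0" by real_asymp
  have "s \<longlonglongrightarrow> l"
    unfolding lim_sequentially
  proof (intro allI impI)
    fix e :: real assume "e > 0"
    then obtain K1 where K1: "\<And>k. k \<ge> K1 \<Longrightarrow> dist (s (k ^ 3)) l < e / 2"
      using l unfolding lim_sequentially by (meson half_gt_zero)
    obtain K2 where K2: "\<And>k. k \<ge> K2 \<Longrightarrow> 12 * C / (real k + 1) < e / 2"
      using order_tendstoD(2)[OF \<open>(\<lambda>k. 12 * C / (real k + 1)) \<longlonglongrightarrow> 0\<close>, of "e / 2"] \<open>e > 0\<close>
      unfolding eventually_sequentially by auto
    define K where "K = max K1 K2"
    have "dist (s n) l < e" if "n \<ge> K ^ 3" for n
    proof -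
      have "\<exists>k\<ge>K. k ^ 3 \<le> n \<and> n < Suc k ^ 3"
        using that
      proof (induction n rule: dec_induct)
        case base
        have "K ^ 3 < Suc K ^ 3" by (intro power_strict_mono) auto
        then show ?case by blast
      next
        case (step n)
        then obtain k where k: "K \<le> k" "k ^ 3 \<le> n" "n < Suc k ^ 3" by blast
        have "Suc k ^ 3 < Suc (Suc k) ^ 3" by (intro power_strict_mono) auto
        then show ?case
          using k by (cases "Suc n = Suc k ^ 3") (metis le_SucI le_refl, metis Suc_lessI le_SucI)
      qed
      then obtain k where k: "k ^ 3 \<le> n" "K \<le> k" and "n < Suc k ^ 3" by blast
      then have "real n \<le> real (Suc k ^ 3)" by (simp only: of_nat_le_iff less_imp_le)
      have "\<bar>s n - s (k ^ 3)\<bar> = \<bar>sum f {k ^ 3..<n}\<bar>" using s_diff[OF k(1)] by simp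
      also have "\<dots> \<le> (\<Sum>j = k ^ 3..<n. C / (real (k ^ 3) + 1))"
        using \<open>C \<ge> 0\<close> by (intro order_trans[OF sum_abs] sum_mono order_trans[OF bound] divide_left_mono mult_pos_pos add_nonneg_pos) auto
      also have "\<dots> = (real n - real (k ^ 3)) * (C / (real (k ^ 3) + 1))"
        using k(1) by (simp add: of_nat_diff)
      \<comment> \<open>Number of terms in the block times the bound on a single term, both
        expressed in \<open>k + 1\<close>.\<close>
      also have "\<dots> \<le> (3 * (real k + 1)\<^sup>2) * (C * 4 / (real k + 1) ^ 3)"
      proof (rule mult_mono)
        show "real n - real (k ^ 3) \<le> 3 * (real k + 1)\<^sup>2"
          using cube_block_bounds(1)[of k] \<open>real n \<le> real (Suc k ^ 3)\<close> by linarith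
        have "C * (real k + 1) ^ 3 \<le> C * (4 * (real (k ^ 3) + 1))"
          using cube_block_bounds(2)[of k] \<open>C \<ge> 0\<close> by (intro mult_left_mono) auto
        moreover have "(real k + 1) ^ 3 > 0" "real (k ^ 3) + 1 > 0" by (auto intro: add_nonneg_pos)
        ultimately show "C / (real (k ^ 3) + 1) \<le> C * 4 / (real k + 1) ^ 3"
          by (simp only: divide_le_eq le_divide_eq times_divide_eq_left mult.assoc if_True)
      qed (use \<open>C \<ge> 0\<close> in auto)
      also have "\<dots> = 12 * C / (real k + 1)"
        by (simp add: power2_eq_square power3_eq_cube add_nonneg_eq_0_iff)
      also have "\<dots> < e / 2" using K2 k(2) by (simp add: K_def)
      finally have "dist (s n) (s (k ^ 3)) < e / 2" by (simp add: dist_real_def)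
      moreover have "dist (s (k ^ 3)) l < e / 2" using K1 k(2) by (simp add: K_def)
      ultimately show ?thesis using dist_triangle[of "s n" l "s (k ^ 3)"] by linarith
    qed
    then show "\<exists>no. \<forall>n\<ge>no. dist (s n) l < e" by blast
  qed
  then show ?thesis unfolding summable_def sums_def s_def by blast
qed

context prob_space
begin

text \<open>By monotone convergence the sum of the absolute values has finite expectation, hence is
  finite almost everywhere.\<close>

lemma AE_summable_of_summable_expectation:
  fixes D :: "nat \<Rightarrow> 'a \<Rightarrow> real"
  assumes int: "\<And>k. integrable M (D k)"
    and sums: "summable (\<lambda>k. expectation (\<lambda>\<omega>. \<bar>D k \<omega>\<bar>))"
  shows "AE \<omega> in M. summable (\<lambda>k. D k \<omega>)"
proof -
  have [measurable]: "D k \<in> borel_measurable M" for k using int by auto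
  have "(\<integral>\<^sup>+ \<omega>. (\<Sum>k. ennreal \<bar>D k \<omega>\<bar>) \<partial>M) = (\<Sum>k. \<integral>\<^sup>+ \<omega>. ennreal \<bar>D k \<omega>\<bar> \<partial>M)"
    by (rule nn_integral_suminf) auto
  also have "\<dots> = (\<Sum>k. ennreal (expectation (\<lambda>\<omega>. \<bar>D k \<omega>\<bar>)))"
    using int by (intro suminf_cong nn_integral_eq_integral) auto
  also have "\<dots> \<noteq> \<infinity>" using sums by (simp add: ennreal_suminf_neq_top)
  finally have "AE \<omega> in M. (\<Sum>k. ennreal \<bar>D k \<omega>\<bar>) \<noteq> \<infinity>"
    by (intro nn_integral_PInf_AE) auto
  then show ?thesis
  proof eventually_elim
    case (elim \<omega>)
    then have "summable (\<lambda>k. \<bar>D k \<omega>\<bar>)" by (intro summable_suminf_not_top) auto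
    then show ?case by (rule summable_rabs_cancel)
  qed
qed

text \<open>A block \<open>{k ^ 3..<(k + 1) ^ 3}\<close> has about \<open>3 k\<^sup>2\<close> terms of size at most \<open>C / k ^ 3\<close>. By orthogonality its
  sum has \<open>L\<^sup>1\<close> norm of order \<open>1 / k\<^sup>2\<close>, which is summable, while partial sums vary by at most order
  \<open>1 / k\<close> inside a block. This replaces the martingale convergence theorem.\<close>

lemma AE_summable_of_orthogonal:
  fixes \<xi> :: "nat \<Rightarrow> 'a \<Rightarrow> real"
  assumes meas [measurable]: "\<And>n. \<xi> n \<in> borel_measurable M"
    and bound: "\<And>n \<omega>. \<omega> \<in> space M \<Longrightarrow> \<bar>\<xi> n \<omega>\<bar> \<le> C / (real n + 1)"
    and orth: "\<And>m n. m < n \<Longrightarrow> expectation (\<lambda>\<omega>. \<xi> m \<omega> * \<xi> n \<omega>) = 0"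
  shows "AE \<omega> in M. summable (\<lambda>n. \<xi> n \<omega>)"
proof -
  have "C \<ge> 0"
    using bound[of _ 0] not_empty by (metis abs_ge_zero add_0 div_by_1 ex_in_conv of_nat_0 order_trans)
  define D where "D k \<omega> = (\<Sum>n = k ^ 3..<Suc k ^ 3. \<xi> n \<omega>)" for k \<omega>
  have int: "integrable M (\<lambda>\<omega>. \<xi> m \<omega> * \<xi> n \<omega>)" for m n
  proof (rule integrable_const_bound)
    show "AE \<omega> in M. norm (\<xi> m \<omega> * \<xi> n \<omega>) \<le> C / (real m + 1) * (C / (real n + 1))"
      using bound \<open>C \<ge> 0\<close> by (intro AE_I2) (auto simp only: real_norm_def abs_mult intro!: mult_mono divide_nonneg_pos)
  qed simp
  have int1: "integrable M (\<xi> n)" for n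
    using bound by (intro integrable_const_bound[of _ "C / (real n + 1)"] AE_I2) auto
  have intD: "integrable M (D k)" for k unfolding D_def using int1 by auto
  have sq: "(D k \<omega>)\<^sup>2 = (\<Sum>m = k ^ 3..<Suc k ^ 3. \<Sum>n = k ^ 3..<Suc k ^ 3. \<xi> m \<omega> * \<xi> n \<omega>)" for k \<omega>
    by (simp add: D_def power2_eq_square sum_product)
  have intD2: "integrable M (\<lambda>\<omega>. (D k \<omega>)\<^sup>2)" for k unfolding sq using int by auto
  \<comment> \<open>Only the diagonal survives: at most \<open>3 * (k + 1)^2\<close> terms, each at
    most \<open>(4 * C / (k + 1) ^ 3)^2\<close>, which yields the constant 48.\<close>
  have second_moment: "expectation (\<lambda>\<omega>. (D k \<omega>)\<^sup>2) \<le> 48 * C\<^sup>2 / (real k + 1) ^ 4" for k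
  proof -
    have "expectation (\<lambda>\<omega>. (D k \<omega>)\<^sup>2)
        = (\<Sum>m = k ^ 3..<Suc k ^ 3. \<Sum>n = k ^ 3..<Suc k ^ 3. expectation (\<lambda>\<omega>. \<xi> m \<omega> * \<xi> n \<omega>))"
      unfolding sq using int by (simp add: Bochner_Integration.integral_sum)
    also have "\<dots> = (\<Sum>m = k ^ 3..<Suc k ^ 3. \<Sum>n = k ^ 3..<Suc k ^ 3.
        if n = m then expectation (\<lambda>\<omega>. \<xi> m \<omega> * \<xi> m \<omega>) else 0)"
    proof (intro sum.cong refl)
      fix m n :: nat
      show "expectation (\<lambda>\<omega>. \<xi> m \<omega> * \<xi> n \<omega>) = (if n = m then expectation (\<lambda>\<omega>. \<xi> m \<omega> * \<xi> m \<omega>) else 0)"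
        using orth[of m n] orth[of n m] by (cases m n rule: linorder_cases) (auto simp: mult.commute)
    qed
    also have "\<dots> = (\<Sum>m = k ^ 3..<Suc k ^ 3. expectation (\<lambda>\<omega>. \<xi> m \<omega> * \<xi> m \<omega>))"
      by (intro sum.cong) auto
    also have "\<dots> \<le> (\<Sum>m = k ^ 3..<Suc k ^ 3. (C * 4 / (real k + 1) ^ 3)\<^sup>2)"
    proof (rule sum_mono)
      fix m assume m: "m \<in> {k ^ 3..<Suc k ^ 3}"
      have "C * (real k + 1) ^ 3 \<le> C * (4 * (real m + 1))"
        using cube_block_bounds(2)[of k] \<open>C \<ge> 0\<close> m
        by (intro mult_left_mono) (auto simp flip: of_nat_power intro: order_trans)
      moreover have "(real k + 1) ^ 3 > 0" "real m + 1 > 0" by (auto intro: add_nonneg_pos)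
      ultimately have "C / (real m + 1) \<le> C * 4 / (real k + 1) ^ 3"
        by (simp only: divide_le_eq le_divide_eq times_divide_eq_left mult.assoc if_True)
      then have "\<bar>\<xi> m \<omega>\<bar> \<le> C * 4 / (real k + 1) ^ 3" if "\<omega> \<in> space M" for \<omega>
        using bound[OF that, of m] by linarith
      then have "\<xi> m \<omega> * \<xi> m \<omega> \<le> (C * 4 / (real k + 1) ^ 3)\<^sup>2" if "\<omega> \<in> space M" for \<omega>
        using power_mono[OF _ abs_ge_zero, of "\<xi> m \<omega>" _ 2] that
        unfolding power2_abs power2_eq_square[of "\<xi> m \<omega>"] by blast
      then have "expectation (\<lambda>\<omega>. \<xi> m \<omega> * \<xi> m \<omega>) \<le> expectation (\<lambda>\<omega>. (C * 4 / (real k + 1) ^ 3)\<^sup>2)"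
        using int by (intro integral_mono) auto
      then show "expectation (\<lambda>\<omega>. \<xi> m \<omega> * \<xi> m \<omega>) \<le> (C * 4 / (real k + 1) ^ 3)\<^sup>2"
        by (simp add: prob_space)
    qed
    also have "\<dots> = (real (Suc k ^ 3) - real (k ^ 3)) * (C * 4 / (real k + 1) ^ 3)\<^sup>2"
      by (subst sum_constant, subst card_atLeastLessThan, subst of_nat_diff) (auto intro!: power_mono)
    also have "\<dots> \<le> 3 * (real k + 1)\<^sup>2 * (C * 4 / (real k + 1) ^ 3)\<^sup>2"
      using cube_block_bounds(1) by (intro mult_right_mono) auto
    also have "\<dots> = 48 * C\<^sup>2 / (real k + 1) ^ 4"
      by (simp add: power_divide power_mult_distrib flip: power_mult) (simp add: eval_nat_numeral add_nonneg_eq_0_iff)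
    finally show ?thesis .
  qed
  have first_moment: "expectation (\<lambda>\<omega>. \<bar>D k \<omega>\<bar>) \<le> (48 * C\<^sup>2 + 1) / (real k + 1)\<^sup>2" for k
  proof -
    \<comment> \<open>The inequality of arithmetic and geometric means does the work of
      Cauchy-Schwarz; the weight \<open>(k + 1)^2\<close> gives both terms an expectation of order
      \<open>1 / (k + 1)^2\<close>.\<close>
    have "\<bar>D k \<omega>\<bar> \<le> (real k + 1)\<^sup>2 * (D k \<omega>)\<^sup>2 + 1 / (real k + 1)\<^sup>2" for \<omega>
    proof -
      have "0 \<le> ((real k + 1) * \<bar>D k \<omega>\<bar> - 1 / (real k + 1))\<^sup>2" by simp
      also have "\<dots> = (real k + 1)\<^sup>2 * (D k \<omega>)\<^sup>2 + 1 / (real k + 1)\<^sup>2 - 2 * \<bar>D k \<omega>\<bar>"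
        by (simp add: power2_diff power_mult_distrib power_divide add_nonneg_eq_0_iff)
      finally show ?thesis by linarith
    qed
    then have "expectation (\<lambda>\<omega>. \<bar>D k \<omega>\<bar>) \<le> expectation (\<lambda>\<omega>. (real k + 1)\<^sup>2 * (D k \<omega>)\<^sup>2 + 1 / (real k + 1)\<^sup>2)"
      using intD intD2 by (intro integral_mono) auto
    also have "\<dots> = (real k + 1)\<^sup>2 * expectation (\<lambda>\<omega>. (D k \<omega>)\<^sup>2) + 1 / (real k + 1)\<^sup>2"
      using intD2 by (simp add: prob_space)
    also have "\<dots> \<le> (real k + 1)\<^sup>2 * (48 * C\<^sup>2 / (real k + 1) ^ 4) + 1 / (real k + 1)\<^sup>2"
      using second_moment by (intro add_right_mono mult_left_mono) auto
    also have "\<dots> = (48 * C\<^sup>2 + 1) / (real k + 1)\<^sup>2"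
      by (simp add: eval_nat_numeral add_nonneg_eq_0_iff add_divide_distrib)
    finally show ?thesis .
  qed
  have "summable (\<lambda>k. 1 / (real k + 1)\<^sup>2)"
    using inverse_power_summable[of 2, where 'a=real] summable_Suc_iff[of "\<lambda>n. inverse ((of_nat n :: real)\<^sup>2)"]
    by (simp add: divide_inverse add.commute)
  then have "summable (\<lambda>k. (48 * C\<^sup>2 + 1) * (1 / (real k + 1)\<^sup>2))" by (rule summable_mult)
  then have "summable (\<lambda>k. expectation (\<lambda>\<omega>. \<bar>D k \<omega>\<bar>))"
    by (rule summable_comparison_test'[where N = 0]) (use first_moment in \<open>simp add: integral_nonneg_AE\<close>)
  then have "AE \<omega> in M. summable (\<lambda>k. D k \<omega>)"
    by (rule AE_summable_of_summable_expectation[OF intD])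
  then show ?thesis
    using AE_space
  proof eventually_elim
    case (elim \<omega>)
    then show ?case
      by (intro summable_of_cube_blocks[OF bound]) (auto simp: D_def)
  qed
qed

end

section \<open>Finiteness of the equilibria set\<close>

text \<open>Summation by parts on the graph: the ordered adjacent pairs are closed under exchanging
  endpoints, so the terms with \<open>u i\<close> and with \<open>u j\<close> contribute equally. It
  converts edge sums into vertex sums.\<close>

lemma sum_edge_pairs_symmetric:
  fixes u :: "'v::finite \<Rightarrow> real" and w :: "'v \<Rightarrow> 'v \<Rightarrow> real"
  assumes "\<And>i j. w i j = w j i"
  shows "(\<Sum>i\<in>UNIV. \<Sum>j | {i, j} \<in> E. (u i + u j) * w i j) = 2 * (\<Sum>i\<in>UNIV. u i * (\<Sum>j | {i, j} \<in> E. w i j))"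
proof -
  let ?P = "{p. {fst p, snd p} \<in> E}"
  have P: "(\<Sum>i\<in>UNIV. \<Sum>j | {i, j} \<in> E. f i j) = (\<Sum>p\<in>?P. f (fst p) (snd p))" for f :: "'v \<Rightarrow> 'v \<Rightarrow> real"
    by (subst sum.Sigma) (auto intro!: sum.cong)
  have "(\<Sum>i\<in>UNIV. \<Sum>j | {i, j} \<in> E. u j * w i j) = (\<Sum>i\<in>UNIV. \<Sum>j | {i, j} \<in> E. u i * w i j)"
    unfolding P by (rule sum.reindex_bij_witness[of _ prod.swap prod.swap])
      (auto simp: insert_commute assms[of "fst _" "snd _"])
  then show ?thesis by (simp add: algebra_simps sum.distrib sum_distrib_left)
qed

text \<open>The factor \<open>G\<close>: the partial derivative of \<open>S\<close> in coordinate
  \<open>i\<close>, divided by the number of edges.\<close>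

definition pull :: "'v::finite set set \<Rightarrow> real ^ 'v \<Rightarrow> 'v \<Rightarrow> real" where
  "pull E x i = (\<Sum>j | {i, j} \<in> E. 1 / (x $ i + x $ j)) / real (card E)"

text \<open>The field for \<open>\<alpha> = 1\<close> in factored form, free of \<open>powr\<close>,
  so that continuity, measurability and the gradient factor are visible.\<close>

definition drift :: "'v::finite set set \<Rightarrow> real ^ 'v \<Rightarrow> real ^ 'v" where
  "drift E x = (\<chi> i. x $ i * (pull E x i - 1))"

lemma vector_field_eq_drift:
  assumes "\<And>i. x $ i \<ge> 0"
  shows "vector_field E 1 x = drift E x"
  using assms by (simp add: vector_field_def drift_def pull_def vec_eq_iff right_diff_distrib
      sum_distrib_left sum_divide_distrib divide_divide_eq_left mult.commute)

text \<open>Along an edge \<open>d\<close> changes sign and keeps its absolute value, so by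
  connectedness the absolute value is constant. If it were nonzero, the sign classes would form a
  bipartition, and the vanishing sum would make them equally large.\<close>

lemma opposite_on_edges_eq_0:
  fixes d :: "'v::finite \<Rightarrow> real"
  assumes "graph_connected E" and nb: "\<not> balanced_bipartite E"
    and "simple_graph E"
    and edge: "\<And>i j. {i, j} \<in> E \<Longrightarrow> d i + d j = 0"
    and zero_sum: "(\<Sum>i\<in>UNIV. d i) = 0"
  shows "d i = 0"
proof (rule ccontr)
  assume "d i \<noteq> 0"
  have abs: "\<bar>d j\<bar> = \<bar>d i\<bar>" for j
  proof -
    have "(i, j) \<in> {(i, j). {i, j} \<in> E}\<^sup>*" using assms(1) by (auto simp: graph_connected_def)
    then show ?thesis
    proof induction
      case (step j k) then show ?case using edge[of j k] by auto
    qed simp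
  qed
  define A where "A = {j. d j > 0}"
  define A' where "A' = {j. d j < 0}"
  have cover: "A \<union> A' = UNIV"
    using abs \<open>d i \<noteq> 0\<close> by (auto simp: A_def A'_def) (metis abs_eq_0_iff linorder_neqE)
  have disj: "A \<inter> A' = {}" by (auto simp: A_def A'_def)
  have "(\<Sum>j\<in>UNIV. d j) = (\<Sum>j\<in>A. d j) + (\<Sum>j\<in>A'. d j)"
    using disj cover by (metis finite sum.union_disjoint)
  also have "(\<Sum>j\<in>A. d j) = (\<Sum>j\<in>A. \<bar>d i\<bar>)"
    by (intro sum.cong refl) (metis A_def abs abs_of_pos mem_Collect_eq)
  also have "(\<Sum>j\<in>A'. d j) = (\<Sum>j\<in>A'. - \<bar>d i\<bar>)"
    by (intro sum.cong refl) (metis A'_def abs abs_of_neg add.inverse_inverse mem_Collect_eq)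
  finally have "card A = card A'" using zero_sum \<open>d i \<noteq> 0\<close> by simp
  moreover have "\<exists>a\<in>A. \<exists>b\<in>A'. e = {a, b}" if "e \<in> E" for e
  proof -
    have "card e = 2" using that assms(3) by (auto simp: simple_graph_def)
    then obtain j k where jk: "e = {j, k}" by (auto simp: card_2_iff)
    have "d j + d k = 0" using edge that jk by blast
    moreover have "d j \<noteq> 0" using abs[of j] \<open>d i \<noteq> 0\<close> by auto
    ultimately consider "j \<in> A" "k \<in> A'" | "k \<in> A" "j \<in> A'"
      unfolding A_def A'_def by fastforce
    then show ?thesis using jk by cases (blast, metis insert_commute)
  qed
  ultimately have "balanced_bipartite E" using cover disj unfolding balanced_bipartite_def by blast
  with nb show False ..
qed

text \<open>Strict concavity of \<open>ln\<close> makes the edge sums \<open>x $ i + x $ j\<close> of an equilibrium unique once its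
  support is fixed; the difference of two such equilibria then alternates in sign along edges.\<close>

lemma finite_equilibria:
  fixes E :: "'v::finite set set"
  assumes "graph_connected E" "\<not> balanced_bipartite E" "simple_graph E" "c > 0"
  shows "finite (equilibria E 1 c)"
proof -
  define supp where "supp = (\<lambda>x :: real ^ 'v. {i. x $ i \<noteq> 0})"
  \<comment> \<open>There are finitely many supports, so it suffices that the support determines the
    equilibrium.\<close>
  have "inj_on supp (equilibria E 1 c)"
  proof (rule inj_onI)
    fix x x' assume x: "x \<in> equilibria E 1 c" and x': "x' \<in> equilibria E 1 c" and "supp x = supp x'"
    then have supp: "x $ i = 0 \<longleftrightarrow> x' $ i = 0" for i by (auto simp: supp_def)
    have *: "y $ i = 0 \<or> pull E y i = 1" if "y \<in> equilibria E 1 c" for y i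
      using that vector_field_eq_drift[of y E]
      by (auto simp: equilibria_def Delta_def drift_def vec_eq_iff)
    have pos: "y $ i + y $ j > 0" if "y \<in> equilibria E 1 c" "{i, j} \<in> E" for y i j
      using that \<open>c > 0\<close> by (force simp: equilibria_def Delta_def)
    let ?w = "\<lambda>i j. 1 / (x $ i + x $ j) - 1 / (x' $ i + x' $ j)"
    let ?d = "\<lambda>i. x $ i - x' $ i"
    \<comment> \<open>On the common support both values of \<open>pull\<close> are 1, so the inner
      sum vanishes; off it \<open>?d i\<close> is 0.\<close>
    have cancel: "?d i * (\<Sum>j | {i, j} \<in> E. ?w i j) = 0" for i
    proof (cases "x $ i = 0")
      case False
      then have "pull E x i = pull E x' i" using *[OF x, of i] *[OF x', of i] supp by auto
      then have "card E = 0 \<or> (\<Sum>j | {i, j} \<in> E. ?w i j) = 0"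
        by (auto simp: pull_def sum_subtractf)
      then show ?thesis by auto
    qed (use supp in auto)
    have "(\<Sum>i\<in>UNIV. \<Sum>j | {i, j} \<in> E. (?d i + ?d j) * ?w i j) = 0"
      by (subst sum_edge_pairs_symmetric) (auto simp: cancel add.commute)
    \<comment> \<open>Since \<open>1 / y\<close> is strictly decreasing, every summand is
      nonpositive, and the vanishing total forces every edge sum of \<open>x\<close> and
      \<open>x'\<close> to agree.\<close>
    moreover have "(?d i + ?d j) * ?w i j
        = - ((?d i + ?d j)\<^sup>2 / ((x $ i + x $ j) * (x' $ i + x' $ j)))" if "{i, j} \<in> E" for i j
    proof -
      have "(a - a') * (1 / a - 1 / a') = - ((a - a')\<^sup>2 / (a * a'))" if "a > 0" "a' > 0" for a a' :: real
        using that by (simp add: field_simps power2_eq_square)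
      from this[OF pos[OF x that] pos[OF x' that]] show ?thesis by (simp add: algebra_simps)
    qed
    ultimately have zero: "(\<Sum>i\<in>UNIV. \<Sum>j | {i, j} \<in> E.
        (?d i + ?d j)\<^sup>2 / ((x $ i + x $ j) * (x' $ i + x' $ j))) = 0"
      by (simp add: sum_negf)
    have nn: "(?d i + ?d j)\<^sup>2 / ((x $ i + x $ j) * (x' $ i + x' $ j)) \<ge> 0" if "{i, j} \<in> E" for i j
      using pos[OF x that] pos[OF x' that] by simp
    have "?d i + ?d j = 0" if e: "{i, j} \<in> E" for i j
    proof -
      have "(\<Sum>j | {i, j} \<in> E. (?d i + ?d j)\<^sup>2 / ((x $ i + x $ j) * (x' $ i + x' $ j))) = 0"
        using zero nn by (subst (asm) sum_nonneg_eq_0_iff) (auto intro!: sum_nonneg)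
      then have "(?d i + ?d j)\<^sup>2 / ((x $ i + x $ j) * (x' $ i + x' $ j)) = 0"
        using nn e by (subst (asm) sum_nonneg_eq_0_iff) auto
      then show ?thesis using pos[OF x e] pos[OF x' e] by simp
    qed
    moreover have "(\<Sum>i\<in>UNIV. ?d i) = 0"
      using x x' by (simp add: equilibria_def Delta_def sum_subtractf)
    ultimately have "?d i = 0" for i using opposite_on_edges_eq_0[OF assms(1-3), of ?d i] by blast
    then show "x = x'" by (simp add: vec_eq_iff)
  qed
  then show ?thesis using finite_image_iff[of supp] by (metis finite)
qed

lemma isCont_drift:
  assumes "\<And>i j. {i, j} \<in> E \<Longrightarrow> z $ i + z $ j \<noteq> 0" and "E \<noteq> {}"
  shows "isCont (drift E) z"
proof -
  have "((\<lambda>x. drift E x) \<longlongrightarrow> drift E z) (at z)"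
    unfolding drift_def pull_def using assms by (intro tendsto_intros) auto
  then show ?thesis by (simp add: isCont_def)
qed

section \<open>The urn process\<close>

text \<open>Follows from \<open>ln t \<le> t - 1\<close> at \<open>t = y / y'\<close>. The quadratic
  loss is uniform above \<open>l\<close>, which suits edge sums bounded away from 0.\<close>

lemma ln_diff_ge_quadratic:
  fixes y y' :: real
  assumes "l > 0" "l \<le> y" "l \<le> y'"
  shows "ln y' - ln y \<ge> (y' - y) / y - (y' - y)\<^sup>2 / l\<^sup>2"
proof -
  have pos: "y > 0" "y' > 0" using assms by auto
  have "ln (y / y') \<le> y / y' - 1" using pos by (intro ln_le_minus_one) auto
  then have "ln y' - ln y \<ge> 1 - y / y'" using pos by (simp add: ln_div)
  also have "1 - y / y' = (y' - y) / y - (y' - y)\<^sup>2 / (y * y')"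
    using pos by (simp add: field_simps power2_eq_square)
  finally have "ln y' - ln y \<ge> (y' - y) / y - (y' - y)\<^sup>2 / (y * y')" .
  moreover have "(y' - y)\<^sup>2 / (y * y') \<le> (y' - y)\<^sup>2 / l\<^sup>2"
    using assms pos by (intro divide_left_mono) (auto simp: power2_eq_square intro!: mult_mono)
  ultimately show ?thesis by linarith
qed

section \<open>The normalised urn and its pathwise bounds\<close>

locale linear_urn = polya_urn M E 1 b X B
  for M :: "'w measure" and E :: "'v::finite set set" and b X B +
  assumes edges: "card E \<ge> 1"
begin

text \<open>The total number of balls after \<open>n\<close> steps, written with the deterministic
  configuration \<open>b\<close> so that it does not depend on the outcome.\<close>

definition mass :: "nat \<Rightarrow> real" where
  "mass n = real (\<Sum>i\<in>UNIV. b i) + real n * real (card E)"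

definition state :: "nat \<Rightarrow> 'w \<Rightarrow> real ^ 'v" where
  "state n \<omega> = (\<chi> i. real (B n i \<omega>) / mass n)"

text \<open>The step size: the share of the balls present after step \<open>n + 1\<close> that this
  step has added.\<close>

definition gain :: "nat \<Rightarrow> real" where
  "gain n = real (card E) / mass (Suc n)"

text \<open>Taken as the remainder of the recursion, which therefore holds at every outcome;
  \<open>noise_eq\<close> identifies it with centred edge choices.\<close>

definition noise :: "nat \<Rightarrow> 'w \<Rightarrow> real ^ 'v" where
  "noise n \<omega> = state (Suc n) \<omega> - state n \<omega> - gain n *\<^sub>R drift E (state n \<omega>)"

lemma proportions_eq_state: "\<omega> \<in> space M \<Longrightarrow> proportions E B n \<omega> = state n \<omega>"
  by (simp add: proportions_def state_def mass_def balls_0)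

lemma initial_mass_ge: "(\<Sum>i\<in>UNIV. b i) \<ge> 1"
  using initial_pos sum_nonneg_leq_bound[of UNIV b] by (metis finite UNIV_I zero_le member_le_sum order_trans)

lemma mass_ge: "mass n \<ge> real n + 1"
proof -
  have "real n * 1 \<le> real n * real (card E)" using edges by (intro mult_left_mono) auto
  moreover have "real (\<Sum>i\<in>UNIV. b i) \<ge> 1" using initial_mass_ge by linarith
  ultimately show ?thesis unfolding mass_def by linarith
qed

lemma mass_pos [simp]: "mass n > 0"
  using mass_ge[of n] by linarith

lemma mass_nonzero [simp]: "mass n \<noteq> 0"
  using mass_pos[of n] by linarith

lemma edges_nonempty [simp]: "E \<noteq> {}"
  using edges by auto

lemma mass_Suc: "mass (Suc n) = mass n + real (card E)"
  by (simp add: mass_def algebra_simps)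

lemma mass_Suc_le: "mass (Suc n) \<le> (real n + 1) * mass 1"
proof -
  have "0 \<le> real n * real (\<Sum>i\<in>UNIV. b i)" by (intro mult_nonneg_nonneg of_nat_0_le_iff)
  then show ?thesis unfolding mass_def by (simp add: algebra_simps)
qed

lemma edge_distinct: "{i, j} \<in> E \<Longrightarrow> i \<noteq> j"
  using simple by (force simp: simple_graph_def)

text \<open>An edge at \<open>i\<close> is determined by its other endpoint, and by
  \<open>choice_endpoint\<close> only edges at \<open>i\<close> can send a ball there. The received
  balls thus become a sum over neighbours, the shape of \<open>pull\<close>.\<close>

lemma hits_eq:
  assumes "\<omega> \<in> space M"
  shows "real (card {e \<in> E. X n e \<omega> = i}) = (\<Sum>j | {i, j} \<in> E. of_bool (X n {i, j} \<omega> = i))"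
proof -
  have "bij_betw (\<lambda>j. {i, j}) {j. {i, j} \<in> E \<and> X n {i, j} \<omega> = i} {e \<in> E. X n e \<omega> = i}"
    unfolding bij_betw_def
  proof
    show "inj_on (\<lambda>j. {i, j}) {j. {i, j} \<in> E \<and> X n {i, j} \<omega> = i}"
      by (auto simp: inj_on_def doubleton_eq_iff)
    have endpoint: "\<exists>j. e = {i, j}" if "e \<in> E" "X n e \<omega> = i" for e
    proof -
      have "i \<in> e" "card e = 2"
        using choice_endpoint[OF that(1) assms, of n] that simple by (auto simp: simple_graph_def)
      then show ?thesis by (auto simp: card_2_iff)
    qed
    have "e \<in> (\<lambda>j. {i, j}) ` {j. {i, j} \<in> E \<and> X n {i, j} \<omega> = i}" if "e \<in> E" "X n e \<omega> = i" for e
    proof -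
      from endpoint[OF that] obtain j where "e = {i, j}" ..
      with that show ?thesis by (intro image_eqI[of _ _ j]) auto
    qed
    then show "(\<lambda>j. {i, j}) ` {j. {i, j} \<in> E \<and> X n {i, j} \<omega> = i} = {e \<in> E. X n e \<omega> = i}"
      by auto
  qed
  from bij_betw_same_card[OF this] show ?thesis
    by (simp add: of_bool_def sum.If_cases Int_def conj_commute)
qed

lemma card_hits_le: "card {e \<in> E. X n e \<omega> = i} \<le> card E"
  by (rule card_mono) auto

lemma balls_ge_1: "\<omega> \<in> space M \<Longrightarrow> B n i \<omega> \<ge> 1"
  by (induction n) (auto simp: balls_0 balls_Suc initial_pos[unfolded One_nat_def])

lemma sum_balls:
  assumes "\<omega> \<in> space M"
  shows "(\<Sum>i\<in>UNIV. real (B n i \<omega>)) = mass n"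
proof (induction n)
  case 0
  then show ?case using assms by (simp add: balls_0 mass_def)
next
  case (Suc n)
  have "(\<Sum>i\<in>UNIV. card {e \<in> E. X n e \<omega> = i}) = card E"
    using sum.group[of E UNIV "\<lambda>e. X n e \<omega>" "\<lambda>_. 1 :: nat"] by simp
  then have "(\<Sum>i\<in>UNIV. real (card {e \<in> E. X n e \<omega> = i})) = real (card E)"
    by (simp flip: of_nat_sum)
  then show ?case using Suc assms by (simp add: balls_Suc sum.distrib mass_Suc)
qed

text \<open>At every step the edge itself gives a ball to one of its endpoints; the 2 accounts for
  the initial balls.\<close>

lemma edge_balls_ge:
  assumes "\<omega> \<in> space M" "{i, j} \<in> E"
  shows "B n i \<omega> + B n j \<omega> \<ge> n + 2"
proof (induction n)
  case 0
  then show ?case using balls_ge_1[OF assms(1), of 0] by (metis add_mono one_add_one add_0)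
next
  case (Suc n)
  let ?hit = "\<lambda>k. card {e \<in> E. X n e \<omega> = k}"
  have hit: "?hit k \<ge> 1" if "X n {i, j} \<omega> = k" for k
  proof -
    have "{i, j} \<in> {e \<in> E. X n e \<omega> = k}" using that assms(2) by simp
    then have "?hit k \<noteq> 0" by (subst card_0_eq) auto
    then show ?thesis by linarith
  qed
  have "X n {i, j} \<omega> = i \<or> X n {i, j} \<omega> = j" using choice_endpoint[OF assms(2,1), of n] by blast
  then have "?hit i + ?hit j \<ge> 1" using hit[of i] hit[of j] by linarith
  then show ?case using Suc assms(1) by (simp add: balls_Suc)
qed

lemma state_nonneg: "state n \<omega> $ i \<ge> 0"
  by (simp add: state_def less_imp_le)

lemma sum_state: "\<omega> \<in> space M \<Longrightarrow> (\<Sum>i\<in>UNIV. state n \<omega> $ i) = 1"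
  using sum_balls[of \<omega> n] mass_pos[of n] by (simp add: state_def less_imp_neq[symmetric] flip: sum_divide_distrib)

lemma state_le_1: "\<omega> \<in> space M \<Longrightarrow> state n \<omega> $ i \<le> 1"
  using sum_state[of \<omega> n] member_le_sum[of i UNIV "\<lambda>i. state n \<omega> $ i"] state_nonneg by simp

lemma edge_state_le_1:
  assumes "\<omega> \<in> space M" "{i, j} \<in> E"
  shows "state n \<omega> $ i + state n \<omega> $ j \<le> 1"
proof -
  have "(\<Sum>k\<in>{i, j}. state n \<omega> $ k) \<le> (\<Sum>k\<in>UNIV. state n \<omega> $ k)"
    using state_nonneg by (intro sum_mono2) auto
  then show ?thesis using edge_distinct[OF assms(2)] sum_state[OF assms(1)] by simp
qed

lemma edge_state_ge:
  assumes "\<omega> \<in> space M" "{i, j} \<in> E"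
  shows "state n \<omega> $ i + state n \<omega> $ j \<ge> (real n + 2) / mass n"
proof -
  have "real n + 2 \<le> real (B n i \<omega>) + real (B n j \<omega>)" using edge_balls_ge[OF assms, of n] by linarith
  then show ?thesis
    using divide_right_mono[of "real n + 2" _ "mass n"] mass_pos[of n]
    by (simp add: state_def less_imp_le flip: add_divide_distrib)
qed

text \<open>A positive bound independent of \<open>n\<close> and of the outcome. It keeps
  \<open>pull\<close> bounded and lets \<open>ln_diff_ge_quadratic\<close> apply with
  \<open>l = 1 / mass 1\<close>.\<close>

lemma edge_state_lower_bound:
  assumes "\<omega> \<in> space M" "{i, j} \<in> E"
  shows "state n \<omega> $ i + state n \<omega> $ j \<ge> 1 / mass 1"
proof -
  have "mass n \<le> mass (Suc n)" by (simp add: mass_Suc)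
  also have "\<dots> \<le> (real n + 2) * mass 1"
    using mass_Suc_le[of n] mass_pos[of 1] by (smt (verit) mult_right_mono)
  finally have "1 / mass 1 \<le> (real n + 2) / mass n"
    using mass_pos[of 1] mass_pos[of n] by (simp add: divide_le_eq le_divide_eq mult.commute)
  then show ?thesis using edge_state_ge[OF assms, of n] by linarith
qed

lemma pull_nonneg: "pull E (state n \<omega>) i \<ge> 0"
  unfolding pull_def by (intro divide_nonneg_nonneg sum_nonneg add_nonneg_nonneg state_nonneg) auto

lemma pull_le:
  assumes "\<omega> \<in> space M"
  shows "pull E (state n \<omega>) i \<le> real CARD('v) * mass 1"
proof -
  have "(\<Sum>j | {i, j} \<in> E. 1 / (state n \<omega> $ i + state n \<omega> $ j)) \<le> (\<Sum>j | {i, j} \<in> E. mass 1)"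
  proof (rule sum_mono)
    fix j assume "j \<in> {j. {i, j} \<in> E}"
    then have le: "1 / mass 1 \<le> state n \<omega> $ i + state n \<omega> $ j"
      using edge_state_lower_bound[OF assms] by blast
    have "0 < 1 / mass 1" by simp
    with le have "0 < state n \<omega> $ i + state n \<omega> $ j" by linarith
    with le show "1 / (state n \<omega> $ i + state n \<omega> $ j) \<le> mass 1"
      by (simp add: divide_le_eq mult.commute)
  qed
  also have "\<dots> \<le> real CARD('v) * mass 1"
    using mass_pos[of 1] by (simp add: card_mono mult_right_mono less_imp_le)
  finally have "pull E (state n \<omega>) i \<le> real CARD('v) * mass 1 / real (card E)"
    unfolding pull_def by (rule divide_right_mono) simp
  also have "\<dots> \<le> real CARD('v) * mass 1 / 1"
    using edges mass_pos[of 1] by (intro divide_left_mono) (auto simp: less_imp_le)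
  finally show ?thesis by simp
qed

section \<open>The recursion: drift, step size and noise\<close>

lemma state_Suc: "state (Suc n) \<omega> = state n \<omega> + gain n *\<^sub>R drift E (state n \<omega>) + noise n \<omega>"
  by (simp add: noise_def)

lemma step_eq:
  assumes "\<omega> \<in> space M"
  shows "state (Suc n) \<omega> $ i - state n \<omega> $ i
    = (real (card {e \<in> E. X n e \<omega> = i}) - real (card E) * state n \<omega> $ i) / mass (Suc n)"
proof -
  have "(b' + h) / (t + m) - b' / t = (h - m * (b' / t)) / (t + m)" if "t > 0" "t + m > 0" for b' h t m :: real
    using that by (simp add: field_simps)
  from this[OF mass_pos[of n], of "real (card E)"] mass_pos[of "Suc n"] show ?thesis
    using assms by (simp add: state_def balls_Suc mass_Suc)
qed

lemma step_le:
  assumes "\<omega> \<in> space M"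
  shows "\<bar>state (Suc n) \<omega> $ i - state n \<omega> $ i\<bar> \<le> real (card E) / (real n + 1)"
proof -
  let ?h = "real (card {e \<in> E. X n e \<omega> = i})"
  have "real (card E) * state n \<omega> $ i \<le> real (card E)"
    using state_le_1[OF assms] by (simp add: mult_left_le)
  moreover have "0 \<le> real (card E) * state n \<omega> $ i" using state_nonneg by simp
  moreover have "?h \<le> real (card E)" "0 \<le> ?h" using card_hits_le by auto
  ultimately have "\<bar>?h - real (card E) * state n \<omega> $ i\<bar> \<le> real (card E)" by linarith
  moreover have "real n + 1 \<le> mass (Suc n)" using mass_ge[of "Suc n"] by simp
  ultimately show ?thesis
    unfolding step_eq[OF assms] abs_divide using mass_pos[of "Suc n"] by (intro frac_le) auto
qed

text \<open>The normalisation \<open>mass n\<close> cancels in each ratio, so the drift accounts for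
  the conditional probabilities of the edge choices, and centred indicators remain.\<close>

lemma noise_eq:
  assumes "\<omega> \<in> space M"
  shows "noise n \<omega> $ i = (\<Sum>j | {i, j} \<in> E. of_bool (X n {i, j} \<omega> = i)
    - real (B n i \<omega>) / (real (B n i \<omega>) + real (B n j \<omega>))) / mass (Suc n)"
proof -
  have ratio: "state n \<omega> $ i * (1 / (state n \<omega> $ i + state n \<omega> $ j))
      = real (B n i \<omega>) / (real (B n i \<omega>) + real (B n j \<omega>))" for j
    using mass_pos[of n] by (simp add: state_def flip: add_divide_distrib)
  have "gain n * drift E (state n \<omega>) $ i
      = (state n \<omega> $ i * (real (card E) * pull E (state n \<omega>) i) - real (card E) * state n \<omega> $ i) / mass (Suc n)"
    by (simp add: gain_def drift_def algebra_simps diff_divide_distrib)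
  also have "state n \<omega> $ i * (real (card E) * pull E (state n \<omega>) i)
      = (\<Sum>j | {i, j} \<in> E. real (B n i \<omega>) / (real (B n i \<omega>) + real (B n j \<omega>)))"
    unfolding ratio[symmetric] sum_distrib_left[symmetric] by (simp add: pull_def)
  finally show ?thesis
    using step_eq[OF assms, of n i] hits_eq[OF assms, of n i]
    by (simp add: noise_def sum_subtractf diff_divide_distrib)
qed

lemma noise_le:
  assumes "\<omega> \<in> space M"
  shows "\<bar>noise n \<omega> $ i\<bar> \<le> real CARD('v) / (real n + 1)"
proof -
  let ?t = "\<lambda>j. of_bool (X n {i, j} \<omega> = i) - real (B n i \<omega>) / (real (B n i \<omega>) + real (B n j \<omega>))"
  have "\<bar>?t j\<bar> \<le> 1" for j
  proof -
    have "0 \<le> real (B n i \<omega>) / (real (B n i \<omega>) + real (B n j \<omega>))"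
      "real (B n i \<omega>) / (real (B n i \<omega>) + real (B n j \<omega>)) \<le> 1"
      by (auto simp: divide_le_eq_1)
    then show ?thesis by (auto simp: of_bool_def)
  qed
  then have "\<bar>\<Sum>j | {i, j} \<in> E. ?t j\<bar> \<le> (\<Sum>j | {i, j} \<in> E. 1)"
    by (intro order_trans[OF sum_abs] sum_mono)
  also have "\<dots> \<le> real CARD('v)" by (simp add: card_mono)
  finally have "\<bar>\<Sum>j | {i, j} \<in> E. ?t j\<bar> \<le> real CARD('v)" .
  moreover have "real n + 1 \<le> mass (Suc n)" using mass_ge[of "Suc n"] by simp
  ultimately show ?thesis
    unfolding noise_eq[OF assms] abs_divide using mass_pos[of "Suc n"] by (intro frac_le) auto
qed

section \<open>Measurability and the martingale difference property\<close>

lemma measurable_balls: "B n i \<in> measurable M (count_space UNIV)"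
proof (induction n arbitrary: i)
  case 0
  have "(\<lambda>_. b i) \<in> measurable M (count_space UNIV)" by simp
  then show ?case by (rule measurable_cong[THEN iffD1, rotated]) (simp add: balls_0)
next
  case (Suc n)
  have [measurable]: "B n i \<in> measurable M (count_space UNIV)" by (fact Suc)
  have [measurable]: "X n e \<in> measurable M (count_space UNIV)" if "e \<in> E" for e
    using that by (rule choice_measurable)
  have "(\<lambda>\<omega>. B n i \<omega> + (\<Sum>e\<in>E. if X n e \<omega> = i then 1 else 0)) \<in> measurable M (count_space UNIV)"
    by measurable
  then show ?case
    by (rule measurable_cong[THEN iffD1, rotated]) (simp add: balls_Suc sum.If_cases Int_def)
qed

lemma subalgebra_history: "subalgebra M (history M B n)"
proof -
  have "{{\<omega> \<in> space M. B k i \<omega> = b} |k i b. k \<le> n} \<subseteq> sets M"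
    using measurable_balls by (auto intro!: measurable_sets_Collect[OF measurable_balls])
  then show ?thesis
    unfolding subalgebra_def history_def
    by (simp add: space_measure_of_conv sets.sigma_sets_subset sets_measure_of_conv)
qed

lemma measurable_balls_history:
  assumes "k \<le> n"
  shows "B k i \<in> measurable (history M B n) (count_space UNIV)"
proof -
  have space: "space (history M B n) = space M" using subalgebra_history by (simp add: subalgebra_def)
  have "B k i -` {a} \<inter> space M \<in> sets (history M B n)" for a
  proof -
    have "{\<omega> \<in> space M. B k i \<omega> = a} \<in> sets (history M B n)"
      unfolding history_def using assms by (subst sets_measure_of) (auto intro!: sigma_sets.Basic)
    then show ?thesis by (simp add: vimage_def Int_def conj_commute)
  qed
  then show ?thesis by (subst measurable_count_space_eq_countable) (auto simp: space)
qed

lemma subalgebra_history_mono: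
  assumes "m \<le> n"
  shows "subalgebra (history M B n) (history M B m)"
proof -
  have sets: "sets (history M B k) = sigma_sets (space M) {{\<omega> \<in> space M. B l i \<omega> = b} |l i b. l \<le> k}" for k
    unfolding history_def by (rule sets_measure_of) auto
  have "space (history M B k) = space M" for k by (simp add: history_def space_measure_of_conv)
  moreover have "sets (history M B m) \<subseteq> sets (history M B n)"
    unfolding sets by (rule sigma_sets_mono') (use assms in fastforce)
  ultimately show ?thesis by (simp add: subalgebra_def)
qed

lemma measurable_state_history:
  assumes "k \<le> n"
  shows "(\<lambda>\<omega>. state k \<omega> $ i) \<in> borel_measurable (history M B n)"
proof -
  have "(\<lambda>\<omega>. real (B k i \<omega>)) \<in> borel_measurable (history M B n)"
    by (rule measurable_compose[OF measurable_balls_history[OF assms]]) simp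
  then show ?thesis by (simp add: state_def)
qed

lemma measurable_pull_history:
  assumes "k \<le> n"
  shows "(\<lambda>\<omega>. pull E (state k \<omega>) i) \<in> borel_measurable (history M B n)"
proof -
  note [measurable] = measurable_state_history[OF assms]
  show ?thesis unfolding pull_def by measurable
qed

text \<open>A single choice \<open>X k e\<close> need not be measurable with respect to any history; only the total
  number of balls a vertex receives is.\<close>

lemma measurable_noise_history:
  assumes "k < n"
  shows "(\<lambda>\<omega>. noise k \<omega> $ i) \<in> borel_measurable (history M B n)"
proof -
  have le: "k \<le> n" "Suc k \<le> n" using assms by auto
  note [measurable] = measurable_state_history[OF le(1)] measurable_state_history[OF le(2)]
    measurable_pull_history[OF le(1)]
  show ?thesis by (simp add: noise_def drift_def)
qed

text \<open>The martingale difference property, tested against a bounded factor known at time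
  \<open>n\<close>. By linearity the edges are treated one at a time, and \<open>choice_prob\<close>
  replaces each indicator by its conditional probability under the expectation.\<close>

lemma expectation_mult_noise:
  assumes Y: "Y \<in> borel_measurable (history M B n)" and bound: "\<And>\<omega>. \<omega> \<in> space M \<Longrightarrow> \<bar>Y \<omega>\<bar> \<le> K"
  shows "expectation (\<lambda>\<omega>. Y \<omega> * noise n \<omega> $ i) = 0"
proof -
  interpret H: finite_measure_subalgebra M "history M B n"
    by unfold_locales (fact subalgebra_history)
  have [measurable]: "Y \<in> borel_measurable M"
    using measurable_from_subalg[OF subalgebra_history Y] .
  have [measurable]: "(\<lambda>\<omega>. real (B n j \<omega>)) \<in> borel_measurable M" for j
    by (rule measurable_compose[OF measurable_balls]) simp
  define p where "p j \<omega> = real (B n i \<omega>) / (real (B n i \<omega>) + real (B n j \<omega>))" for j \<omega>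
  define A where "A j = {\<omega> \<in> space M. X n {i, j} \<omega> = i}" for j
  have [measurable]: "p j \<in> borel_measurable M" for j unfolding p_def by measurable
  have A [measurable]: "A j \<in> sets M" if "{i, j} \<in> E" for j
    unfolding A_def by (rule measurable_sets_Collect[OF choice_measurable[OF that]]) auto
  have p01: "0 \<le> p j \<omega>" "p j \<omega> \<le> 1" for j \<omega> by (auto simp: p_def divide_le_eq_1)
  have bounded: "integrable M (\<lambda>\<omega>. Y \<omega> * f \<omega>)"
    if [measurable]: "f \<in> borel_measurable M" and "\<And>\<omega>. \<bar>f \<omega>\<bar> \<le> 1" for f
  proof (rule integrable_const_bound)
    have "\<bar>Y \<omega>\<bar> * \<bar>f \<omega>\<bar> \<le> K * 1" if "\<omega> \<in> space M" for \<omega>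
      using bound[OF that] \<open>\<And>\<omega>. \<bar>f \<omega>\<bar> \<le> 1\<close>[of \<omega>] by (intro mult_mono) auto
    then show "AE \<omega> in M. norm (Y \<omega> * f \<omega>) \<le> K" by (intro AE_I2) (simp add: abs_mult)
  qed simp
  have int_A: "integrable M (\<lambda>\<omega>. Y \<omega> * indicator (A j) \<omega>)" if "{i, j} \<in> E" for j
    using A[OF that] by (intro bounded) (auto simp: indicator_def)
  have int_p: "integrable M (\<lambda>\<omega>. Y \<omega> * p j \<omega>)" for j
    using p01 by (intro bounded) auto
  have unbiased: "expectation (\<lambda>\<omega>. Y \<omega> * indicator (A j) \<omega>) = expectation (\<lambda>\<omega>. Y \<omega> * p j \<omega>)"
    if e: "{i, j} \<in> E" for j
  proof -
    have "AE \<omega> in M. real_cond_exp M (history M B n) (indicator (A j)) \<omega> = p j \<omega>"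
      using choice_prob[OF e, of n] by (simp add: A_def p_def)
    then have "expectation (\<lambda>\<omega>. Y \<omega> * real_cond_exp M (history M B n) (indicator (A j)) \<omega>)
        = expectation (\<lambda>\<omega>. Y \<omega> * p j \<omega>)"
      by (intro integral_cong_AE) auto
    then show ?thesis
      using H.real_cond_exp_intg(2)[OF int_A[OF e] Y] A[OF e] by simp
  qed
  have "expectation (\<lambda>\<omega>. Y \<omega> * noise n \<omega> $ i)
      = expectation (\<lambda>\<omega>. (\<Sum>j | {i, j} \<in> E. Y \<omega> * indicator (A j) \<omega> - Y \<omega> * p j \<omega>) / mass (Suc n))"
    by (intro Bochner_Integration.integral_cong refl)
      (simp add: noise_eq A_def p_def indicator_def of_bool_def sum_distrib_left right_diff_distrib)
  also have "\<dots> = (\<Sum>j | {i, j} \<in> E. expectation (\<lambda>\<omega>. Y \<omega> * indicator (A j) \<omega>)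
      - expectation (\<lambda>\<omega>. Y \<omega> * p j \<omega>)) / mass (Suc n)"
    using int_A int_p by (simp add: Bochner_Integration.integral_sum)
  also have "\<dots> = 0" using unbiased by simp
  finally show ?thesis .
qed

text \<open>A martingale transform with bounded multipliers. For \<open>m < n\<close> every factor
  of the mixed product except \<open>noise n\<close> is determined by the history up to
  \<open>n\<close>, so the terms are orthogonal; their decay comes from
  \<open>noise_le\<close>.\<close>

lemma AE_summable_mult_noise:
  assumes meas: "\<And>n. Y n \<in> borel_measurable (history M B n)"
    and bound: "\<And>n \<omega>. \<omega> \<in> space M \<Longrightarrow> \<bar>Y n \<omega>\<bar> \<le> K"
  shows "AE \<omega> in M. summable (\<lambda>n. Y n \<omega> * noise n \<omega> $ i)"
proof (rule AE_summable_of_orthogonal[where C = "K * real CARD('v)"])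
  have noise_meas: "(\<lambda>\<omega>. noise n \<omega> $ i) \<in> borel_measurable M" for n
    using measurable_from_subalg[OF subalgebra_history measurable_noise_history[OF lessI]] .
  have "Y n \<in> borel_measurable M" for n
    using measurable_from_subalg[OF subalgebra_history meas] .
  then show "(\<lambda>\<omega>. Y n \<omega> * noise n \<omega> $ i) \<in> borel_measurable M" for n
    using noise_meas by simp
  show le: "\<bar>Y n \<omega> * noise n \<omega> $ i\<bar> \<le> K * real CARD('v) / (real n + 1)" if "\<omega> \<in> space M" for n \<omega>
    using mult_mono[OF bound[OF that, of n] noise_le[OF that, of n i]] bound[OF that, of n]
    by (simp add: abs_mult)
  show "expectation (\<lambda>\<omega>. Y m \<omega> * noise m \<omega> $ i * (Y n \<omega> * noise n \<omega> $ i)) = 0" if "m < n" for m n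
  proof -
    have "(\<lambda>\<omega>. Y m \<omega> * noise m \<omega> $ i * Y n \<omega>) \<in> borel_measurable (history M B n)"
      using measurable_from_subalg[OF subalgebra_history_mono[OF less_imp_le[OF that]] meas] meas measurable_noise_history[OF that]
      by (intro borel_measurable_times) auto
    moreover have "\<bar>Y m \<omega> * noise m \<omega> $ i * Y n \<omega>\<bar> \<le> (K * real CARD('v) / (real m + 1)) * K"
      if "\<omega> \<in> space M" for \<omega>
      unfolding abs_mult[of "_ * _"]
      using mult_mono[OF le[OF that, of m] bound[OF that, of n]] le[OF that, of m] by linarith
    ultimately have "expectation (\<lambda>\<omega>. (Y m \<omega> * noise m \<omega> $ i * Y n \<omega>) * noise n \<omega> $ i) = 0"
      by (rule expectation_mult_noise)
    then show ?thesis by (simp add: mult.assoc)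
  qed
qed

section \<open>The energy as a Lyapunov function\<close>

definition energy :: "nat \<Rightarrow> 'w \<Rightarrow> real" where
  "energy n \<omega> = (\<Sum>i\<in>UNIV. \<Sum>j | {i, j} \<in> E. ln (state n \<omega> $ i + state n \<omega> $ j))"

lemma energy_nonpos:
  assumes "\<omega> \<in> space M"
  shows "energy n \<omega> \<le> 0"
  unfolding energy_def
proof (intro sum_nonpos)
  fix i j assume "j \<in> {j. {i, j} \<in> E}"
  then have e: "{i, j} \<in> E" by simp
  have "0 < 1 / mass 1" by simp
  then show "ln (state n \<omega> $ i + state n \<omega> $ j) \<le> 0"
    using edge_state_le_1[OF assms e, of n] edge_state_lower_bound[OF assms e, of n] 
    by (subst ln_le_zero_iff) linarith+
qed

text \<open>Up to the factor \<open>2 * card E\<close> the gradient of the energy along the simplex is \<open>pull E x i - 1\<close>,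
  since every edge occurs twice in the sum.\<close>

lemma energy_increment:
  assumes "\<omega> \<in> space M"
  shows "2 * real (card E) * (gain n * (norm (drift E (state n \<omega>)))\<^sup>2)
    \<le> energy (Suc n) \<omega> - energy n \<omega>
      + (real CARD('v) ^ 2 * (2 * real (card E) * mass 1)\<^sup>2 / (real n + 1)\<^sup>2
         - 2 * real (card E) * (\<Sum>i\<in>UNIV. (pull E (state n \<omega>) i - 1) * noise n \<omega> $ i))"
proof -
  define d where "d i = state (Suc n) \<omega> $ i - state n \<omega> $ i" for i
  define y where "y i j = state n \<omega> $ i + state n \<omega> $ j" for i j
  define g where "g i = pull E (state n \<omega>) i - 1" for i
  \<comment> \<open>The quadratic loss of one logarithm: an edge increment is at most
    \<open>2 * card E / (n + 1)\<close>, and \<open>l = 1 / mass 1\<close> contributes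
    \<open>(mass 1)^2\<close>.\<close>
  define q where "q = (2 * real (card E) * mass 1)\<^sup>2 / (real n + 1)\<^sup>2"
  have "q \<ge> 0" by (simp add: q_def)
  have ln: "ln (state (Suc n) \<omega> $ i + state (Suc n) \<omega> $ j) - ln (y i j) \<ge> (d i + d j) * (1 / y i j) - q"
    if e: "{i, j} \<in> E" for i j
  proof -
    have "ln (state (Suc n) \<omega> $ i + state (Suc n) \<omega> $ j) - ln (y i j)
        \<ge> (d i + d j) / y i j - (d i + d j)\<^sup>2 / (1 / mass 1)\<^sup>2"
      using ln_diff_ge_quadratic[OF _ edge_state_lower_bound[OF assms e, of n] edge_state_lower_bound[OF assms e, of "Suc n"]]
      by (simp add: d_def y_def algebra_simps)
    moreover have "\<bar>d i + d j\<bar> \<le> 2 * real (card E) / (real n + 1)"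
      using step_le[OF assms, of n i] step_le[OF assms, of n j] unfolding d_def by (simp add: abs_if split: if_splits)
    then have "(d i + d j)\<^sup>2 \<le> (2 * real (card E) / (real n + 1))\<^sup>2"
      by (metis abs_ge_zero power2_abs power_mono)
    then have "(d i + d j)\<^sup>2 * (mass 1)\<^sup>2 \<le> (2 * real (card E) / (real n + 1))\<^sup>2 * (mass 1)\<^sup>2"
      by (rule mult_right_mono) simp
    then have "(d i + d j)\<^sup>2 / (1 / mass 1)\<^sup>2 \<le> q"
      by (simp add: q_def power_divide power_mult_distrib)
    ultimately show ?thesis by simp
  qed
  \<comment> \<open>The increments are tangent to the simplex, so \<open>pull\<close> may be shifted
    by the constant 1 in the first-order term.\<close>
  have sum_d: "(\<Sum>i\<in>UNIV. d i) = 0"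
    using sum_state[OF assms] by (simp add: d_def sum_subtractf)
  have "(\<Sum>i\<in>UNIV. \<Sum>j | {i, j} \<in> E. (d i + d j) * (1 / y i j))
      = 2 * (\<Sum>i\<in>UNIV. d i * (\<Sum>j | {i, j} \<in> E. 1 / y i j))"
    by (rule sum_edge_pairs_symmetric) (simp add: y_def add.commute)
  also have "\<dots> = 2 * (\<Sum>i\<in>UNIV. d i * (real (card E) * (g i + 1)))"
    using edges by (simp add: g_def pull_def y_def)
  also have "\<dots> = 2 * real (card E) * (\<Sum>i\<in>UNIV. d i * g i) + 2 * real (card E) * (\<Sum>i\<in>UNIV. d i)"
    by (simp add: sum_distrib_left sum_distrib_right sum.distrib algebra_simps)
  finally have first_order: "(\<Sum>i\<in>UNIV. \<Sum>j | {i, j} \<in> E. (d i + d j) * (1 / y i j))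
      = 2 * real (card E) * (\<Sum>i\<in>UNIV. d i * g i)"
    using sum_d by simp
  have "(\<Sum>i\<in>UNIV. \<Sum>j | {i, j} \<in> E. (d i + d j) * (1 / y i j))
      \<le> (\<Sum>i\<in>UNIV. \<Sum>j | {i, j} \<in> E. ln (state (Suc n) \<omega> $ i + state (Suc n) \<omega> $ j) - ln (y i j) + q)"
    using ln by (intro sum_mono) (simp add: algebra_simps)
  also have "\<dots> = energy (Suc n) \<omega> - energy n \<omega> + (\<Sum>i\<in>UNIV. \<Sum>j | {i, j} \<in> E. q)"
    by (simp add: energy_def y_def sum.distrib sum_subtractf)
  also have "(\<Sum>i\<in>UNIV. \<Sum>j | {i, j} \<in> E. q) \<le> (\<Sum>i\<in>(UNIV :: 'v set). \<Sum>j\<in>(UNIV :: 'v set). q)"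
    using \<open>q \<ge> 0\<close> by (intro sum_mono sum_mono2) auto
  also have "\<dots> = real CARD('v) ^ 2 * q" by (simp add: power2_eq_square)
  finally have energy_ge: "2 * real (card E) * (\<Sum>i\<in>UNIV. d i * g i)
      \<le> energy (Suc n) \<omega> - energy n \<omega> + real CARD('v) ^ 2 * q"
    using first_order by simp
  have "gain n \<ge> 0" using mass_pos[of "Suc n"] by (simp add: gain_def less_imp_le)
  \<comment> \<open>A coordinate lies between 0 and 1, so its square times \<open>(g i)^2\<close> is
    at most itself times \<open>(g i)^2\<close>. This turns the ascent term into the squared norm of
    the drift.\<close>
  have "(drift E (state n \<omega>) $ i)\<^sup>2 \<le> drift E (state n \<omega>) $ i * g i" for i
  proof -
    have "(drift E (state n \<omega>) $ i)\<^sup>2 = state n \<omega> $ i * (state n \<omega> $ i * (g i)\<^sup>2)"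
      by (simp add: drift_def g_def power2_eq_square)
    also have "\<dots> \<le> 1 * (state n \<omega> $ i * (g i)\<^sup>2)"
      using state_le_1[OF assms] state_nonneg by (intro mult_right_mono) auto
    also have "\<dots> = drift E (state n \<omega>) $ i * g i"
      by (simp add: drift_def g_def power2_eq_square)
    finally show ?thesis .
  qed
  then have "gain n * (\<Sum>i\<in>UNIV. (drift E (state n \<omega>) $ i)\<^sup>2) \<le> gain n * (\<Sum>i\<in>UNIV. drift E (state n \<omega>) $ i * g i)"
    using \<open>gain n \<ge> 0\<close> by (intro mult_left_mono sum_mono)
  also have "\<dots> = (\<Sum>i\<in>UNIV. d i * g i) - (\<Sum>i\<in>UNIV. g i * noise n \<omega> $ i)"
    by (simp add: d_def state_Suc sum_distrib_left algebra_simps flip: sum_subtractf)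
  finally have "gain n * (norm (drift E (state n \<omega>)))\<^sup>2 \<le> (\<Sum>i\<in>UNIV. d i * g i) - (\<Sum>i\<in>UNIV. g i * noise n \<omega> $ i)"
    unfolding power2_norm_eq_inner inner_vec_def by (simp add: power2_eq_square)
  then have "2 * real (card E) * (gain n * (norm (drift E (state n \<omega>)))\<^sup>2)
      \<le> 2 * real (card E) * ((\<Sum>i\<in>UNIV. d i * g i) - (\<Sum>i\<in>UNIV. g i * noise n \<omega> $ i))"
    by (rule mult_left_mono) simp
  then show ?thesis
    using energy_ge unfolding q_def g_def by (simp add: right_diff_distrib)
qed

section \<open>Almost sure convergence\<close>

lemma not_summable_gain: "\<not> summable gain"
proof
  assume "summable gain"
  then have "summable (\<lambda>n. mass 1 * gain n)" by (rule summable_mult)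
  \<comment> \<open>The linear upper bound on \<open>mass\<close> compares \<open>gain\<close> from
    below with the harmonic series.\<close>
  moreover have "norm (inverse (real n + 1)) \<le> mass 1 * gain n" for n
  proof -
    have "(real n + 1) * mass 1 * 1 \<le> (real n + 1) * mass 1 * real (card E)"
      using edges by (intro mult_left_mono mult_nonneg_nonneg) (auto simp: less_imp_le)
    then have "mass (Suc n) \<le> (real n + 1) * (mass 1 * real (card E))"
      using mass_Suc_le[of n] unfolding mult_1_right mult.assoc by (rule order_trans[rotated])
    then show ?thesis
      by (simp add: gain_def inverse_eq_divide divide_le_eq le_divide_eq mult.commute add_nonneg_pos)
  qed
  ultimately have "summable (\<lambda>n. inverse (real n + 1))"
    by (metis summable_comparison_test')
  then show False
    using not_summable_harmonic[where 'a = real] summable_Suc_iff[of "\<lambda>n. inverse (real n)"]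
    by (simp add: add.commute)
qed

text \<open>Probability enters through two almost sure events: in each coordinate the noise, and the
  noise weighted by \<open>pull - 1\<close>, are summable. On them the deterministic lemmas apply to
  each trajectory.\<close>

lemma AE_limit_in_equilibria:
  assumes "finite (equilibria E 1 c)" and "0 < c" and c: "c \<le> 1 / real (card E)"
  shows "AE \<omega> in M. \<exists>l\<in>equilibria E 1 c. (\<lambda>n. state n \<omega>) \<longlonglongrightarrow> l"
proof -
  have noise1: "AE \<omega> in M. \<forall>i. summable (\<lambda>n. 1 * noise n \<omega> $ i)"
    unfolding AE_all_countable by (intro allI AE_summable_mult_noise[where K = 1]) auto
  have noise2: "AE \<omega> in M. \<forall>i. summable (\<lambda>n. (pull E (state n \<omega>) i - 1) * noise n \<omega> $ i)"
    unfolding AE_all_countable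
  proof (intro allI AE_summable_mult_noise[where K = "real CARD('v) * mass 1 + 1"])
    show "(\<lambda>\<omega>. pull E (state n \<omega>) i - 1) \<in> borel_measurable (history M B n)" for n i
      using measurable_pull_history[of n n i] by simp
    show "\<bar>pull E (state n \<omega>) i - 1\<bar> \<le> real CARD('v) * mass 1 + 1" if "\<omega> \<in> space M" for n i \<omega>
      using pull_le[OF that, of n i] pull_nonneg[of n \<omega> i] by linarith
  qed
  show ?thesis
    using noise1 noise2 AE_space
  proof eventually_elim
    case (elim \<omega>)
    note \<omega> = elim(3)
    have gain_nonneg: "gain n \<ge> 0" for n
      using mass_pos[of "Suc n"] by (simp add: gain_def less_imp_le)
    \<comment> \<open>Expansion along the standard basis passes from coordinatewise to vector
      summability.\<close>
    have "summable (\<lambda>n. \<Sum>i\<in>UNIV. noise n \<omega> $ i *\<^sub>R axis i (1 :: real))"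
      using elim(1) by (intro summable_sum summable_scaleR_left) auto
    moreover have "(\<Sum>i\<in>UNIV. noise n \<omega> $ i *\<^sub>R axis i (1 :: real)) = noise n \<omega>" for n
      by (simp add: vec_eq_iff axis_def if_distrib cong: if_cong)
    ultimately have noise: "summable (\<lambda>n. noise n \<omega>)" by simp
    have "summable (\<lambda>n. inverse ((real (Suc n))\<^sup>2))"
      using inverse_power_summable[of 2, where 'a = real] summable_Suc_iff[of "\<lambda>n. inverse ((real n)\<^sup>2)"] by simp
    then have "summable (\<lambda>n. real CARD('v) ^ 2 * (2 * real (card E) * mass 1)\<^sup>2 * inverse ((real (Suc n))\<^sup>2))"
      by (rule summable_mult)
    then have "summable (\<lambda>n. real CARD('v) ^ 2 * (2 * real (card E) * mass 1)\<^sup>2 / (real n + 1)\<^sup>2)"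
      by (simp add: divide_inverse add.commute)
    moreover have "summable (\<lambda>n. 2 * real (card E) * (\<Sum>i\<in>UNIV. (pull E (state n \<omega>) i - 1) * noise n \<omega> $ i))"
      using elim(2) by (intro summable_mult summable_sum) auto
    ultimately have "summable (\<lambda>n. real CARD('v) ^ 2 * (2 * real (card E) * mass 1)\<^sup>2 / (real n + 1)\<^sup>2
         - 2 * real (card E) * (\<Sum>i\<in>UNIV. (pull E (state n \<omega>) i - 1) * noise n \<omega> $ i))"
      by (rule summable_diff)
    \<comment> \<open>The energy is at most 0, and its increments dominate the drift term up to the
      summable error just obtained.\<close>
    then have "summable (\<lambda>n. 2 * real (card E) * (gain n * (norm (drift E (state n \<omega>)))\<^sup>2))"
      using gain_nonneg
      by (intro summable_of_bounded_telescope[where s = "\<lambda>n. energy n \<omega>" and u = 0, OF _ energy_increment[OF \<omega>] energy_nonpos[OF \<omega>]]) auto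
    then have energy: "summable (\<lambda>n. gain n * (norm (drift E (state n \<omega>)))\<^sup>2)"
      using edges by (subst (asm) summable_cmult_iff) auto
    have limits: "z \<in> equilibria E 1 c" if r: "strict_mono r" "((\<lambda>n. state n \<omega>) \<circ> r) \<longlonglongrightarrow> z" for r z
    proof -
      have comp: "(\<lambda>k. state (r k) \<omega> $ i) \<longlonglongrightarrow> z $ i" for i
        using tendsto_vec_nth[OF r(2), of i] by (simp add: o_def)
      have nonneg: "z $ i \<ge> 0" for i
        using LIMSEQ_le_const[OF comp[of i], of 0] state_nonneg by auto
      have "(\<lambda>k. \<Sum>i\<in>UNIV. state (r k) \<omega> $ i) \<longlonglongrightarrow> (\<Sum>i\<in>UNIV. z $ i)"
        by (intro tendsto_sum comp)
      then have sum1: "(\<Sum>i\<in>UNIV. z $ i) = 1"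
        using sum_state[OF \<omega>] by (simp add: LIMSEQ_const_iff)
      \<comment> \<open>The uniform bound \<open>1 / mass 1\<close> may lie below \<open>c\<close>;
        the sharper bound \<open>edge_state_ge\<close> gives in the limit \<open>1 / card E\<close>,
        which is at least \<open>c\<close> and puts \<open>z\<close> into
        \<open>Delta E c\<close>.\<close>
      have "(\<lambda>n. (real n + 2) / (a + real n * m)) \<longlonglongrightarrow> inverse m" if "m > 0" for a m :: real
        using that by real_asymp
      then have "(\<lambda>n. (real n + 2) / mass n) \<longlonglongrightarrow> 1 / real (card E)"
        unfolding mass_def inverse_eq_divide using edges by simp
      from LIMSEQ_subseq_LIMSEQ[OF this r(1)]
      have ratio: "(\<lambda>k. (real (r k) + 2) / mass (r k)) \<longlonglongrightarrow> 1 / real (card E)" by (simp add: o_def)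
      have edge: "z $ i + z $ j \<ge> c" if "{i, j} \<in> E" for i j
        using LIMSEQ_le[OF ratio tendsto_add[OF comp[of i] comp[of j]]] edge_state_ge[OF \<omega> that] c by force
      have "isCont (drift E) z"
        using edge \<open>0 < c\<close> edges by (intro isCont_drift) (force, auto)
      then have "drift E z = 0"
        by (rule subsequence_limit_zero_of_drift[OF state_Suc gain_nonneg not_summable_gain noise energy _ r])
      then show ?thesis
        using nonneg sum1 edge vector_field_eq_drift[OF nonneg] by (simp add: equilibria_def Delta_def)
    qed
    have null: "(\<lambda>n. real CARD('v) * (real (card E) / (real n + 1))) \<longlonglongrightarrow> 0" by real_asymp
    have step_bound: "dist (state (Suc n) \<omega>) (state n \<omega>) \<le> real CARD('v) * (real (card E) / (real n + 1))" for n
    proof -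
      have "dist (state (Suc n) \<omega>) (state n \<omega>) \<le> (\<Sum>i\<in>UNIV. \<bar>(state (Suc n) \<omega> - state n \<omega>) $ i\<bar>)"
        unfolding dist_norm by (rule norm_le_l1_cart)
      also have "\<dots> \<le> (\<Sum>i\<in>(UNIV :: 'v set). real (card E) / (real n + 1))"
        using step_le[OF \<omega>] by (intro sum_mono) simp
      finally show ?thesis by simp
    qed
    have steps: "(\<lambda>n. dist (state (Suc n) \<omega>) (state n \<omega>)) \<longlonglongrightarrow> 0"
      by (rule Lim_null_comparison[OF _ null]) (simp add: step_bound del: times_divide_eq_right)
    have "state n \<omega> \<in> cbox 0 1" for n
      using state_nonneg state_le_1[OF \<omega>] by (auto simp: mem_box_cart)
    from convergent_of_finite_limit_set[OF compact_cbox this steps assms(1) limits]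
    show ?case .
  qed
qed

end

theorem corollary1p3:
  fixes M :: "'w measure"
    and E :: "'v::finite set set"
    and c :: real
    and b :: "'v \<Rightarrow> nat"
    and X :: "nat \<Rightarrow> 'v set \<Rightarrow> 'w \<Rightarrow> 'v"
    and B :: "nat \<Rightarrow> 'v \<Rightarrow> 'w \<Rightarrow> nat"
  assumes "simple_graph E"
    and "graph_connected E"
    and "card E \<ge> 1"
    and "\<not> balanced_bipartite E"
    and "0 < c" and "c < 1 / real (card E)"
    and "polya_urn M E 1 b X B"
  shows "finite (equilibria E 1 c) \<and>
         (AE \<omega> in M. \<exists>l\<in>equilibria E 1 c. (\<lambda>n. proportions E B n \<omega>) \<longlonglongrightarrow> l)"
proof
  interpret polya_urn M E 1 b X B by fact
  interpret linear_urn M E b X B by unfold_locales fact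
  show fin: "finite (equilibria E 1 c)"
    using assms by (intro finite_equilibria)
  have "AE \<omega> in M. \<exists>l\<in>equilibria E 1 c. (\<lambda>n. state n \<omega>) \<longlonglongrightarrow> l"
    using assms by (intro AE_limit_in_equilibria fin) auto
  \<comment> \<open>\<open>state\<close> and \<open>proportions\<close> agree on the sample space,
    where the initial counts are \<open>b\<close>.\<close>
  then show "AE \<omega> in M. \<exists>l\<in>equilibria E 1 c. (\<lambda>n. proportions E B n \<omega>) \<longlonglongrightarrow> l"
    using AE_space by eventually_elim (simp add: proportions_eq_state)
qed

end
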